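(* Let $c,a\in\mathbb R$ with $c<a$, let $L>0$, and let $h:[c,a]\to\mathbb R$ be an $L$-Lipschitz mapping such that $h(x)<x$ for each $x\in(c,a]$ and $c$ is the unique fixed point of $h$ in $[c,a]$. Let $x_0\in[c,a]$ and, for each $n\ge 0$, define $$x_{n+1}=(1-t)x_n+t\,h(x_n).$$ Then for each $0<t\le\frac{1}{1+L}$ the sequence $\{x_n\}$ converges to $c$.
   Context: A function $h:[c,a]\to\mathbb R$ is called $L$-Lipschitz (for $L>0$) if $|h(x)-h(y)|\le L|x-y|$ for all $x,y\in[c,a]$. A fixed point of $h$ is a point $x$ of its domain with $h(x)=x$. Note that $h$ is not assumed to map $[c,a]$ into itself; that the iterates remain in $[c,a]$ (so that the recursion is well defined) is understood as part of the assertion. *)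

theory Defs
  imports "HOL-Analysis.Lipschitz"
begin

end

theory Submission
  imports Defs
begin

text \<open>The Lipschitz bound at \<open>c\<close> gives \<open>h y - c \<ge> - L (y - c)\<close>, so \<open>t (1 + L) \<le> 1\<close> is exactly what
  prevents an averaged step from overshooting \<open>c\<close>. The iterates therefore decrease inside \<open>[c, a]\<close>,
  and by continuity their limit is a fixed point.\<close>

theorem lemma2p2:
  fixes c a L t :: real and h :: "real \<Rightarrow> real" and x :: "nat \<Rightarrow> real"
  assumes "c < a" and "L > 0"
    and "L-lipschitz_on {c..a} h"
    and "\<forall>y\<in>{c<..a}. h y < y"
    and "h c = c" and "\<forall>y\<in>{c..a}. h y = y \<longrightarrow> y = c"
    and "x 0 \<in> {c..a}"
    and "\<forall>n. x (Suc n) = (1 - t) * x n + t * h (x n)"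
    and "0 < t" and "t \<le> 1 / (1 + L)"
  shows "(\<forall>n. x n \<in> {c..a}) \<and> x \<longlonglongrightarrow> c"
proof -
  have t: "t * (1 + L) \<le> 1"
    using \<open>t \<le> 1 / (1 + L)\<close> \<open>L > 0\<close> by (simp add: pos_le_divide_eq)
  have h_le: "h y \<le> y" if "y \<in> {c..a}" for y
    using that assms(4,5) by (cases "y = c") (auto intro: less_imp_le)
  \<comment> \<open>In this form the sign of the gap \<open>x n - h (x n)\<close> gives monotonicity
    and its size gives the lower bound.\<close>
  have rec: "x (Suc n) = x n - t * (x n - h (x n))" for n
    using assms(8) by (simp add: algebra_simps)
  have step: "x (Suc n) \<le> x n \<and> c \<le> x (Suc n)" if "x n \<in> {c..a}" for n
  proof
    show "x (Suc n) \<le> x n"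
      unfolding rec using h_le[OF that] \<open>0 < t\<close> by simp
    have "dist (h (x n)) (h c) \<le> L * dist (x n) c"
      using lipschitz_onD[OF assms(3) that, of c] \<open>c < a\<close> by simp
    \<comment> \<open>Only the side \<open>c - h (x n) \<le> L * (x n - c)\<close> of the Lipschitz
      bound matters; adding \<open>x n - c\<close> yields the factor \<open>1 + L\<close>.\<close>
    hence "x n - h (x n) \<le> (1 + L) * (x n - c)"
      using that \<open>h c = c\<close> by (auto simp: dist_real_def algebra_simps)
    hence "t * (x n - h (x n)) \<le> (t * (1 + L)) * (x n - c)"
      using \<open>0 < t\<close> by (simp add: mult.assoc)
    also have "\<dots> \<le> x n - c"
      using mult_right_mono[OF t, of "x n - c"] that by simp
    finally show "c \<le> x (Suc n)"
      unfolding rec by simp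
  qed
  have mem: "x n \<in> {c..a}" for n
    by (induction n) (use assms(7) step in fastforce)+
  have "decseq x"
    using step mem by (simp add: decseq_Suc_iff)
  then obtain l where l: "x \<longlonglongrightarrow> l"
    using mem by (auto elim: decseq_convergent[of x c])
  \<comment> \<open>Continuity of \<open>h\<close> and uniqueness of its fixed point are known only
    on the interval, so \<open>l\<close> must be placed there first.\<close>
  have "l \<in> {c..a}"
    using closed_sequentially[OF closed_atLeastAtMost _ l] mem by blast
  have "(\<lambda>n. h (x n)) \<longlonglongrightarrow> h l"
    using continuous_on_tendsto_compose[OF lipschitz_on_continuous_on[OF assms(3)] l \<open>l \<in> {c..a}\<close>] mem
    by simp
  hence "(\<lambda>n. x (Suc n)) \<longlonglongrightarrow> l - t * (l - h l)"
    unfolding rec by (intro tendsto_intros l)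
  \<comment> \<open>The shifted sequence also tends to \<open>l\<close>; since \<open>t > 0\<close>,
    this equation forces \<open>h l = l\<close>.\<close>
  hence "l - t * (l - h l) = l"
    using LIMSEQ_unique LIMSEQ_Suc[OF l] by blast
  hence "l = c"
    using \<open>0 < t\<close> \<open>l \<in> {c..a}\<close> assms(6) by simp
  with l mem show ?thesis by simp
qed

end
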